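(* Let $G$ be a $2$-connected finite simple graph that is not isomorphic to the $4$-cycle $C_4$. Then $FD(G)>2$.
   Context: A graph is $2$-connected if it is connected, has at least $3$ vertices and has no cut vertex. A set is dominating if every vertex outside it has a neighbour in it. A $(k,s)$-configuration of $G$ is a multiset of $k$ (not necessarily distinct) dominating sets such that every vertex lies in at most $s$ of them. $FD(G)$ is the maximum of $k/s$ over all $(k,s)$ for which $G$ admits a $(k,s)$-configuration. *)

theory Defs
  imports Complex_Main "HOL-Library.Multiset" "Graph_Theory.Graph_Theory"
begin

(* Finite simple graphs are the finite symmetric loop-free digraphs without parallel arcs
   (locale graph). *)

(* A vertex separating two other vertices of the same component. *)
definition cut_vertex :: "('a, 'b) pre_digraph \<Rightarrow> 'a \<Rightarrow> bool" where
  "cut_vertex G v \<longleftrightarrow> v \<in> verts G \<and>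
     (\<exists>u \<in> verts G - {v}. \<exists>w \<in> verts G - {v}.
        u \<rightarrow>\<^sup>*\<^bsub>G\<^esub> w \<and> \<not> u \<rightarrow>\<^sup>*\<^bsub>pre_digraph.del_vert G v\<^esub> w)"

definition two_connected :: "('a, 'b) pre_digraph \<Rightarrow> bool" where
  "two_connected G \<longleftrightarrow>
     connected G \<and> card (verts G) \<ge> 3 \<and> \<not> (\<exists>v. cut_vertex G v)"

(* The cycle C_n for n \<ge> 3; for n = 1 it has a loop. *)
definition cycle_graph :: "nat \<Rightarrow> nat pair_pre_digraph" where
  "cycle_graph n = \<lparr> pverts = {..<n},
     parcs = {(i, j). i < n \<and> j < n \<and> (j = Suc i mod n \<or> i = Suc j mod n)} \<rparr>"

definition dominating_set :: "('a, 'b) pre_digraph \<Rightarrow> 'a set \<Rightarrow> bool" where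
  "dominating_set G D \<longleftrightarrow>
     D \<subseteq> verts G \<and> (\<forall>v \<in> verts G - D. \<exists>u \<in> D. v \<rightarrow>\<^bsub>G\<^esub> u)"

definition configuration ::
    "('a, 'b) pre_digraph \<Rightarrow> nat \<Rightarrow> nat \<Rightarrow> 'a set multiset \<Rightarrow> bool" where
  "configuration G k s M \<longleftrightarrow>
     size M = k \<and> (\<forall>D \<in># M. dominating_set G D) \<and>
     (\<forall>v \<in> verts G. size {#D \<in># M. v \<in> D#} \<le> s)"

(* The condition s > 0 only excludes the meaningless ratio k / 0: on a nonempty graph s = 0
   forces k = 0. On nonempty finite graphs the maximum exists, since it is the optimal value of
   a feasible and bounded linear program with integer coefficients. *)
definition FD :: "('a, 'b) pre_digraph \<Rightarrow> real" where
  "FD G = (GREATEST q. \<exists>k s M. s > 0 \<and> configuration G k s M \<and> q = real k / real s)"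

end

theory Submission
  imports Defs
begin

text \<open>If every vertex \<open>v\<close> is missed by some pair of disjoint dominating sets, then these pairs,
  collected over all \<open>n\<close> vertices, form a \<open>(2n, n - 1)\<close>-configuration. Such a pair is a
  2-colouring of \<open>G - v\<close> in which every vertex has a neighbour of the other colour and the
  neighbours of \<open>v\<close> are not all of one colour. A colouring of part of \<open>G - v\<close> with the first
  property always extends, so it suffices to start with two neighbours of \<open>v\<close> and two distinct
  further neighbours of these. This start is impossible only if all neighbours of \<open>v\<close> have
  the neighbourhood \<open>{v, x}\<close> for a single \<open>x\<close>. As \<open>x\<close> is not a cut vertex, \<open>G\<close> is then the
  complete bipartite graph with parts of sizes 2 and \<open>m\<close>, which is the 4-cycle for
  \<open>m = 2\<close> and has a \<open>(3m - 2, m)\<close>-configuration for \<open>m \<ge> 3\<close>.\<close>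

section \<open>Existence of a maximal ratio\<close>

text \<open>Induction over the coordinates: a subsequence is monotone in the new coordinate, and
  passing to it keeps the earlier coordinates increasing.\<close>

lemma dickson:
  fixes f :: "nat \<Rightarrow> 'a \<Rightarrow> nat"
  assumes "finite A"
  shows "\<exists>r. strict_mono r \<and> (\<forall>a\<in>A. incseq (\<lambda>n. f (r n) a))"
  using assms
proof (induction A)
  case empty
  show ?case by (intro exI[of _ id]) (simp add: strict_mono_def)
next
  case (insert a A)
  then obtain r where r: "strict_mono r" "\<And>a. a \<in> A \<Longrightarrow> incseq (\<lambda>n. f (r n) a)" by blast
  obtain g where g: "strict_mono g" "monoseq (\<lambda>n. f (r (g n)) a)"
    using seq_monosub[of "\<lambda>n. f (r n) a"] by blast
  have "\<exists>h. strict_mono h \<and> incseq (\<lambda>n. f (r (g (h n))) a)"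
  proof (cases "incseq (\<lambda>n. f (r (g n)) a)")
    case True
    then show ?thesis by (intro exI[of _ id]) (simp add: strict_mono_def)
  next
    case False
    then have dec: "decseq (\<lambda>n. f (r (g n)) a)" using g(2) by (simp add: monoseq_iff)
    \<comment> \<open>A decreasing sequence of naturals stays at its least value from some
      \<open>N\<close> on, so shifting by \<open>N\<close> makes it constant.\<close>
    obtain N where N: "\<And>n. f (r (g N)) a \<le> f (r (g n)) a"
      using ex_has_least_nat[of "\<lambda>_. True" 0 "\<lambda>n. f (r (g n)) a"] by blast
    have "f (r (g (N + n))) a = f (r (g N)) a" for n
      using N[of "N + n"] decseqD[OF dec, of N "N + n"] by simp
    then show ?thesis
      by (intro exI[of _ "\<lambda>n. N + n"]) (simp add: strict_mono_def incseq_def)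
  qed
  then obtain h where h: "strict_mono h" "incseq (\<lambda>n. f (r (g (h n))) a)" by blast
  have gh: "strict_mono (\<lambda>n. g (h n))" using g(1) h(1) by (simp add: strict_mono_def)
  have "incseq (\<lambda>n. f (r (g (h n))) b)" if "b \<in> A" for b
    using r(2)[OF that] strict_mono_mono[OF gh] unfolding mono_def by simp
  moreover have "strict_mono (\<lambda>n. r (g (h n)))" using r(1) gh by (simp add: strict_mono_def)
  ultimately show ?case using h(2) by (intro exI[of _ "\<lambda>n. r (g (h n))"]) auto
qed

lemma filter_mset_replicate_mset:
  "filter_mset P (replicate_mset n a) = (if P a then replicate_mset n a else {#})"
  by (induction n) auto

lemma dominating_set_nonempty:
  assumes "dominating_set G D" "verts G \<noteq> {}"
  shows "D \<noteq> {}"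
  using assms by (auto simp: dominating_set_def)

lemma configuration_zero:
  assumes "configuration G k 0 M" "verts G \<noteq> {}"
  shows "k = 0"
proof (rule ccontr)
  assume "k \<noteq> 0"
  then have "M \<noteq> {#}" using assms(1) by (auto simp: configuration_def)
  then obtain D where D: "D \<in># M" by blast
  then have dom: "dominating_set G D" using assms(1) by (simp add: configuration_def)
  then obtain v where v: "v \<in> D" using dominating_set_nonempty assms(2) by blast
  then have "v \<in> verts G" using dom by (auto simp: dominating_set_def)
  then have "{#D \<in># M. v \<in> D#} = {#}" using assms(1) by (auto simp: configuration_def)
  moreover have "D \<in># {#D \<in># M. v \<in> D#}" using D v by simp
  ultimately show False by (metis empty_not_add_mset insert_DiffM)
qed

text \<open>Inclusion alone does not bound the loads of the difference. The slack condition
  rearranges to: the load of \<open>v\<close> grows by at most \<open>s' - s\<close>.\<close>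

lemma configuration_diff:
  assumes "configuration G k s M" "configuration G k' s' M'" "M \<subseteq># M'"
    and "\<And>v. v \<in> verts G \<Longrightarrow> s - size {#D \<in># M. v \<in> D#} \<le> s' - size {#D \<in># M'. v \<in> D#}"
  shows "configuration G (k' - k) (s' - s) (M' - M)"
  unfolding configuration_def
proof (intro conjI ballI)
  show "size (M' - M) = k' - k"
    using assms(1-3) by (simp add: configuration_def size_Diff_submset)
  show "dominating_set G D" if "D \<in># M' - M" for D
    using assms(2) that by (auto simp: configuration_def dest: in_diffD)
  fix v assume v: "v \<in> verts G"
  have "size {#D \<in># M' - M. v \<in> D#} = size {#D \<in># M'. v \<in> D#} - size {#D \<in># M. v \<in> D#}"
    using assms(3) by (simp add: size_Diff_submset multiset_filter_mono)
  moreover have "size {#D \<in># M. v \<in> D#} \<le> s" "size {#D \<in># M'. v \<in> D#} \<le> s'"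
    using assms(1,2) v by (auto simp: configuration_def)
  ultimately show "size {#D \<in># M' - M. v \<in> D#} \<le> s' - s" using assms(4)[OF v] by linarith
qed

text \<open>If no ratio were maximal, there would be an infinite sequence of configurations, each of
  least total size among those with a larger ratio than its predecessor. By Dickson's lemma,
  some configuration of the sequence would contain an earlier one, and their difference would be
  smaller with an even larger ratio.\<close>

lemma max_ratio_attained:
  assumes fin: "finite (verts G)" and ne: "verts G \<noteq> {}"
  shows "\<exists>s M. s > 0 \<and> configuration G (size M) s M \<and>
    (\<forall>s' M'. s' > 0 \<and> configuration G (size M') s' M' \<longrightarrow>
       real (size M') / real s' \<le> real (size M) / real s)"
proof (rule ccontr)
  define conf where "conf p \<longleftrightarrow> fst p > 0 \<and> configuration G (size (snd p)) (fst p) (snd p)"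
    for p :: "nat \<times> 'a set multiset"
  define ratio where "ratio p = real (size (snd p)) / real (fst p)" for p :: "nat \<times> 'a set multiset"
  define total where "total p = fst p + size (snd p)" for p :: "nat \<times> 'a set multiset"
  define succ where "succ p = (ARG_MIN total q. conf q \<and> ratio p < ratio q)" for p
  assume no: "\<not> ?thesis"
  have ex: "\<exists>q. conf q \<and> ratio p < ratio q" if "conf p" for p
  proof (rule ccontr)
    assume nex: "\<not> ?thesis"
    have "real (size M') / real s' \<le> ratio p"
      if "s' > 0" "configuration G (size M') s' M'" for s' M'
    proof -
      have "conf (s', M')" using that by (simp add: conf_def)
      then have "\<not> ratio p < ratio (s', M')" using nex by blast
      then show ?thesis by (simp add: ratio_def not_less)
    qed
    then have "\<exists>s M. s > 0 \<and> configuration G (size M) s M \<and>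
      (\<forall>s' M'. s' > 0 \<and> configuration G (size M') s' M' \<longrightarrow>
         real (size M') / real s' \<le> real (size M) / real s)"
      using that by (intro exI[of _ "fst p"] exI[of _ "snd p"]) (simp add: conf_def ratio_def)
    with no show False ..
  qed
  have succ: "conf (succ p) \<and> ratio p < ratio (succ p)" if "conf p" for p
    unfolding succ_def using ex[OF that] by (metis (mono_tags, lifting) arg_min_natI)
  have succ_min: "total (succ p) \<le> total q" if "conf q" "ratio p < ratio q" for p q
    unfolding succ_def using that by (intro arg_min_nat_le) auto
  define c where "c n = (succ ^^ n) (1, {#})" for n
  have conf_c: "conf (c n)" for n
  proof (induction n)
    case 0
    show ?case by (simp add: c_def conf_def configuration_def)
  next
    case (Suc n)
    then show ?case using succ by (simp add: c_def)
  qed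
  have ratio_c: "strict_mono (\<lambda>n. ratio (c n))"
    unfolding strict_mono_Suc_iff using succ conf_c by (simp add: c_def)
  define load where "load p v = size {#D \<in># snd p. v \<in> D#}" for p :: "nat \<times> 'a set multiset" and v
  \<comment> \<open>The coordinates for Dickson's lemma are the bound \<open>s\<close>, the
    multiplicity of each set, and the slack of each vertex, as \<open>configuration_diff\<close>
    requires.\<close>
  define f where "f n i = (case i of None \<Rightarrow> fst (c n) | Some (Inl D) \<Rightarrow> count (snd (c n)) D
      | Some (Inr v) \<Rightarrow> fst (c n) - load (c n) v)" for n i
  define I where "I = insert None (Some ` (Inl ` Pow (verts G) \<union> Inr ` verts G))"
  have "finite I" using fin by (simp add: I_def)
  then obtain r where r: "strict_mono r" "\<And>i. i \<in> I \<Longrightarrow> incseq (\<lambda>n. f (r n) i)"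
    using dickson[of I f] by blast
  define p where "p = c (r 0)"
  \<comment> \<open>Since \<open>r 1 > r 0\<close>, the index \<open>r 1\<close> is a successor, so
    \<open>q\<close> has least total among the configurations with a larger ratio than
    \<open>c j\<close>.\<close>
  obtain j where j: "r (Suc 0) = Suc j"
    using strict_monoD[OF r(1), of 0 1] by (cases "r 1") auto
  define q where "q = c (Suc j)"
  have le: "f (r 0) i \<le> f (r 1) i" if "i \<in> I" for i
    using incseqD[OF r(2)[OF that], of 0 1] by simp
  have le_s: "fst p \<le> fst q" using le[of None] by (simp add: I_def f_def p_def q_def j)
  have cp: "conf p" and cq: "conf q" using conf_c by (simp_all add: p_def q_def)
  have sub: "snd p \<subseteq># snd q"
  proof (rule mset_subset_eqI)
    fix D
    show "count (snd p) D \<le> count (snd q) D"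
    proof (cases "D \<subseteq> verts G")
      case True
      then show ?thesis using le[of "Some (Inl D)"] by (auto simp: I_def f_def p_def q_def j)
    next
      case False
      then have "D \<notin># snd p"
        using cp by (auto simp: conf_def configuration_def dominating_set_def)
      then show ?thesis by (simp add: not_in_iff)
    qed
  qed
  have slack: "fst p - load p v \<le> fst q - load q v" if "v \<in> verts G" for v
    using le[of "Some (Inr v)"] that by (auto simp: I_def f_def p_def q_def j)
  have rpq: "ratio p < ratio q"
    using strict_monoD[OF ratio_c strict_monoD[OF r(1), of 0 1]] by (simp add: p_def q_def j)
  define d where "d = (fst q - fst p, snd q - snd p)"
  have size_d: "size (snd d) = size (snd q) - size (snd p)"
    using sub by (simp add: d_def size_Diff_submset)
  have size_le: "size (snd p) \<le> size (snd q)" using sub by (rule size_mset_mono)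
  have config_d: "configuration G (size (snd d)) (fst d) (snd d)"
    using configuration_diff[of G "size (snd p)" "fst p" "snd p" "size (snd q)" "fst q" "snd q"]
      cp cq sub slack size_d by (simp add: conf_def load_def d_def)
  have pos: "fst p > 0" "fst q > 0" using cp cq by (auto simp: conf_def)
  have cross: "real (size (snd p)) * real (fst q) < real (size (snd q)) * real (fst p)"
    using rpq pos by (simp add: ratio_def field_simps)
  \<comment> \<open>With equal bounds, the difference would be a configuration with bound 0, hence
    empty, and the ratios would agree.\<close>
  have lt_s: "fst p < fst q"
  proof (rule ccontr)
    assume "\<not> ?thesis"
    then have eq: "fst p = fst q" using le_s by simp
    then have "configuration G (size (snd d)) 0 (snd d)" using config_d by (simp add: d_def)
    then have "size (snd q) - size (snd p) = 0" using configuration_zero ne size_d by metis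
    then show False using cross eq pos by simp
  qed
  then have cd: "conf d" using config_d by (simp add: conf_def d_def)
  \<comment> \<open>Mediant inequality: removing a part of smaller ratio raises the ratio of the
    rest.\<close>
  have "ratio q < ratio d"
    using cross pos lt_s size_le size_d
    by (simp add: ratio_def d_def of_nat_diff field_simps)
  then have "ratio (c j) < ratio d"
    using strict_monoD[OF ratio_c, of j "Suc j"] by (simp add: q_def)
  then have "total q \<le> total d"
    using succ_min[OF cd, of "c j"] by (simp add: q_def c_def)
  then show False using lt_s pos size_d by (simp add: total_def d_def)
qed

text \<open>\<open>GREATEST\<close> is only informative once a maximum is known to exist; then any
  single configuration bounds \<open>FD G\<close> from below.\<close>

lemma FD_ge:
  assumes "finite (verts G)" "verts G \<noteq> {}" "s > 0" "configuration G k s M"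
  shows "real k / real s \<le> FD G"
proof -
  define P where "P q \<longleftrightarrow> (\<exists>k s M. s > 0 \<and> configuration G k s M \<and> q = real k / real s)" for q
  obtain s0 M0 where s0: "s0 > 0" "configuration G (size M0) s0 M0"
    and max: "\<And>s' M'. s' > 0 \<Longrightarrow> configuration G (size M') s' M' \<Longrightarrow>
       real (size M') / real s' \<le> real (size M0) / real s0"
    using max_ratio_attained[OF assms(1,2)] by blast
  have top: "q \<le> real (size M0) / real s0" if "P q" for q
    using that max by (auto simp: P_def configuration_def)
  have "P (real (size M0) / real s0)" using s0 unfolding P_def by blast
  then have "Greatest P = real (size M0) / real s0" using top by (rule Greatest_equality)
  moreover have "FD G = Greatest P" unfolding FD_def P_def ..
  moreover have "P (real k / real s)" using assms(3,4) unfolding P_def by blast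
  ultimately show ?thesis using top by simp
qed

section \<open>Extending partial colourings\<close>

text \<open>Pick an uncoloured \<open>w\<close> and a neighbour \<open>y\<close>. If
  \<open>y\<close> is coloured, \<open>w\<close> gets the opposite colour; otherwise both get new,
  opposite colours. Old colours never change, so old witnesses survive.\<close>

lemma good_colouring_extends:
  fixes R :: "'a \<Rightarrow> 'a \<Rightarrow> bool" and c :: "'a \<Rightarrow> bool"
  assumes "finite W" "U \<subseteq> W" and irrefl: "\<And>u. \<not> R u u" and sym: "\<And>u w. R u w \<Longrightarrow> R w u"
    and "\<And>u. u \<in> W \<Longrightarrow> \<exists>w\<in>W. R u w"
    and "\<And>u. u \<in> U \<Longrightarrow> \<exists>w\<in>U. R u w \<and> c w \<noteq> c u"
  shows "\<exists>c'. (\<forall>u\<in>U. c' u = c u) \<and> (\<forall>u\<in>W. \<exists>w\<in>W. R u w \<and> c' w \<noteq> c' u)"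
  using assms(2,6)
proof (induction "card (W - U)" arbitrary: U c rule: less_induct)
  case less
  show ?case
  proof (cases "W \<subseteq> U")
    case True
    then show ?thesis using less.prems by (intro exI[of _ c]) blast
  next
    case False
    then obtain w where w: "w \<in> W" "w \<notin> U" by blast
    then obtain y where y: "y \<in> W" "R w y" using assms(5) by blast
    have "w \<noteq> y" using y irrefl by auto
    define d where "d = (if y \<in> U then c(w := \<not> c y) else c(w := True, y := False))"
    let ?U = "insert w (insert y U)"
    have agree: "d u = c u" if "u \<in> U" for u using that w by (auto simp: d_def)
    have "\<exists>z\<in>?U. R u z \<and> d z \<noteq> d u" if "u \<in> ?U" for u
    proof (cases "u \<in> U")
      case True
      then show ?thesis using less.prems(2)[OF True] agree by (metis insertCI)
    next
      case False
      have "d w \<noteq> d y" using \<open>w \<noteq> y\<close> w by (auto simp: d_def)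
      then show ?thesis using False that y(2) sym[OF y(2)] by auto
    qed
    moreover have "?U \<subseteq> W" using less.prems(1) w y by auto
    moreover have "card (W - ?U) < card (W - U)"
      using w \<open>finite W\<close> by (intro psubset_card_mono) auto
    ultimately obtain c' where "\<forall>u\<in>?U. c' u = d u" "\<forall>u\<in>W. \<exists>w\<in>W. R u w \<and> c' w \<noteq> c' u"
      using less.hyps[of ?U d] by blast
    then show ?thesis using agree by (intro exI[of _ c']) auto
  qed
qed

section \<open>Neighbours and disjoint dominating sets in 2-connected graphs\<close>

context graph
begin

lemma dominates_sym: "u \<rightarrow>\<^bsub>G\<^esub> w \<Longrightarrow> w \<rightarrow>\<^bsub>G\<^esub> u"
  using sym_arcs by (rule arcs_ends_symmetric)

lemma two_connected_reachable:
  assumes "two_connected G" "u \<in> verts G" "w \<in> verts G"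
  shows "u \<rightarrow>\<^sup>* w"
  using assms reachable_mk_symmetric_eq[OF sym_arcs]
  by (auto simp: two_connected_def connected_def strongly_connected_def)

text \<open>Since \<open>v\<close> is no cut vertex, a walk from \<open>u\<close> to
  \<open>w\<close> avoids \<open>v\<close>, and closedness carries membership in \<open>C\<close>
  along it.\<close>

lemma two_connected_closed_set:
  assumes "two_connected G" "u \<in> verts G - {v}" "w \<in> verts G - {v}" "v \<in> verts G" "u \<in> C"
    and closed: "\<And>a b. a \<in> C \<Longrightarrow> a \<rightarrow>\<^bsub>G\<^esub> b \<Longrightarrow> b \<noteq> v \<Longrightarrow> b \<in> C"
  shows "w \<in> C"
proof -
  interpret H: wf_digraph "del_vert v" by (rule wf_digraph_del_vert)
  have "u \<rightarrow>\<^sup>* w" using two_connected_reachable assms by auto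
  then have "u \<rightarrow>\<^sup>*\<^bsub>del_vert v\<^esub> w"
    using assms(1-4) by (auto simp: two_connected_def cut_vertex_def)
  then show ?thesis
  proof (induction rule: H.reachable_induct)
    case (step x y)
    have "x \<rightarrow>\<^bsub>G\<^esub> y" "y \<noteq> v" using step.hyps(2) by (auto simp: arcs_ends_conv del_vert_simps)
    then show ?case using closed step.IH by blast
  qed (use assms in auto)
qed

text \<open>Otherwise \<open>{u}\<close> would be closed away from \<open>w\<close>, and so would
  contain a third vertex.\<close>

lemma two_connected_other_neighbour:
  assumes tc: "two_connected G" and u: "u \<in> verts G" and w: "w \<in> verts G" "u \<noteq> w"
  shows "\<exists>y. u \<rightarrow>\<^bsub>G\<^esub> y \<and> y \<noteq> w"
proof (rule ccontr)
  assume no: "\<not> ?thesis"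
  have "\<not> verts G \<subseteq> {u, w}"
  proof
    assume "verts G \<subseteq> {u, w}"
    then have "card (verts G) \<le> card {u, w}" by (intro card_mono) auto
    then show False using tc w by (simp add: two_connected_def)
  qed
  then obtain z where z: "z \<in> verts G" "z \<noteq> u" "z \<noteq> w" by auto
  have "z \<in> {u}"
    by (rule two_connected_closed_set[OF tc, of u w z]) (use no u w z in auto)
  then show False using z by simp
qed

lemma two_connected_two_neighbours:
  assumes tc: "two_connected G" and v: "v \<in> verts G"
  obtains a b where "v \<rightarrow>\<^bsub>G\<^esub> a" "v \<rightarrow>\<^bsub>G\<^esub> b" "a \<noteq> b"
proof -
  have "\<not> verts G \<subseteq> {v}"
  proof
    assume "verts G \<subseteq> {v}"
    then have "card (verts G) \<le> card {v}" by (intro card_mono) auto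
    then show False using tc by (simp add: two_connected_def)
  qed
  then obtain w where "w \<in> verts G" "v \<noteq> w" by auto
  then obtain a where a: "v \<rightarrow>\<^bsub>G\<^esub> a" using two_connected_other_neighbour[OF tc v] by blast
  then have "a \<in> verts G" "v \<noteq> a" using adj_in_verts adj_not_same by auto
  then obtain b where "v \<rightarrow>\<^bsub>G\<^esub> b" "b \<noteq> a" using two_connected_other_neighbour[OF tc v] by blast
  with a that show thesis by blast
qed

text \<open>Prescribing opposite colours to \<open>s\<close> and \<open>s'\<close>, with \<open>y\<close> and \<open>y'\<close> as neighbours of the
  opposite colour, is consistent because \<open>s \<noteq> s'\<close> and \<open>y \<noteq> y'\<close>.\<close>

lemma disjoint_dominating_sets:
  assumes tc: "two_connected G" and v: "v \<in> verts G"
    and s: "v \<rightarrow>\<^bsub>G\<^esub> s" "v \<rightarrow>\<^bsub>G\<^esub> s'" "s \<noteq> s'" and y: "s \<rightarrow>\<^bsub>G\<^esub> y" "s' \<rightarrow>\<^bsub>G\<^esub> y'" "y \<noteq> y'" "y \<noteq> v" "y' \<noteq> v"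
  shows "\<exists>A B. dominating_set G A \<and> dominating_set G B \<and> A \<inter> B = {} \<and> v \<notin> A \<and> v \<notin> B"
proof -
  let ?W = "verts G - {v}"
  define c where "c u \<longleftrightarrow> u = s \<or> u = y'" for u
  have ne: "s \<noteq> y" "s' \<noteq> y'" "s \<noteq> v" "s' \<noteq> v" using s y adj_not_same by blast+
  have "\<exists>w\<in>?W. u \<rightarrow>\<^bsub>G\<^esub> w" if "u \<in> ?W" for u
    using two_connected_other_neighbour[OF tc, of u v] that v adj_in_verts by blast
  moreover have "\<exists>w\<in>{s, y, s', y'}. u \<rightarrow>\<^bsub>G\<^esub> w \<and> c w \<noteq> c u" if "u \<in> {s, y, s', y'}" for u
    using that s y ne dominates_sym[OF y(1)] dominates_sym[OF y(2)] unfolding c_def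
    by (metis insertCI insertE empty_iff)
  moreover have "{s, y, s', y'} \<subseteq> ?W" using s y ne adj_in_verts by blast
  ultimately obtain c' where c': "\<forall>u\<in>{s, y, s', y'}. c' u = c u"
    "\<forall>u\<in>?W. \<exists>w\<in>?W. u \<rightarrow>\<^bsub>G\<^esub> w \<and> c' w \<noteq> c' u"
    using good_colouring_extends[of ?W "{s, y, s', y'}" "\<lambda>u w. u \<rightarrow>\<^bsub>G\<^esub> w" c]
      adj_not_same dominates_sym by fastforce
  \<comment> \<open>Both classes omit \<open>v\<close>; the opposite colours of its neighbours
    \<open>s\<close> and \<open>s'\<close> ensure that both dominate it.\<close>
  have cs: "c' s" "\<not> c' s'" using c'(1) s y ne by (auto simp: c_def)
  have sW: "s \<in> ?W" "s' \<in> ?W" using s ne adj_in_verts by blast+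
  have "dominating_set G {u \<in> ?W. c' u}" "dominating_set G {u \<in> ?W. \<not> c' u}"
    unfolding dominating_set_def using c'(2) cs s sW by blast+
  then show ?thesis
    by (intro exI[of _ "{u \<in> ?W. c' u}"] exI[of _ "{u \<in> ?W. \<not> c' u}"]) auto
qed

section \<open>Configurations of ratio above 2\<close>

lemma FD_gt_two_if_all_avoidable:
  assumes card: "card (verts G) \<ge> 3"
    and ex: "\<And>v. v \<in> verts G \<Longrightarrow> \<exists>A B. dominating_set G A \<and> dominating_set G B \<and>
      A \<inter> B = {} \<and> v \<notin> A \<and> v \<notin> B"
  shows "FD G > 2"
proof -
  obtain A B where AB: "\<And>v. v \<in> verts G \<Longrightarrow> dominating_set G (A v) \<and> dominating_set G (B v) \<and>
      A v \<inter> B v = {} \<and> v \<notin> A v \<and> v \<notin> B v"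
    using ex by metis
  let ?V = "verts G" and ?n = "card (verts G)"
  let ?M = "image_mset A (mset_set ?V) + image_mset B (mset_set ?V)"
  have "configuration G (2 * ?n) (?n - 1) ?M"
    unfolding configuration_def
  proof (intro conjI ballI)
    show "size ?M = 2 * ?n" by simp
    show "dominating_set G D" if "D \<in># ?M" for D using that AB by auto
    fix u assume u: "u \<in> ?V"
    \<comment> \<open>The pair chosen for \<open>v\<close> covers \<open>u\<close> at most once by
      disjointness, and not at all if \<open>v = u\<close>; hence the bound
      \<open>n - 1\<close>.\<close>
    have "size {#D \<in># ?M. u \<in> D#} = card {v \<in> ?V. u \<in> A v} + card {v \<in> ?V. u \<in> B v}"
      by (simp add: filter_mset_image_mset)
    also have "\<dots> = card ({v \<in> ?V. u \<in> A v} \<union> {v \<in> ?V. u \<in> B v})"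
      using AB by (intro card_Un_disjoint[symmetric]) auto
    also have "\<dots> \<le> card (?V - {u})" using AB by (intro card_mono) auto
    finally show "size {#D \<in># ?M. u \<in> D#} \<le> ?n - 1" using u by simp
  qed
  then have "real (2 * ?n) / real (?n - 1) \<le> FD G"
    using card by (intro FD_ge) auto
  moreover have "2 < real (2 * ?n) / real (?n - 1)" using card by (simp add: field_simps of_nat_diff)
  ultimately show ?thesis by (rule less_le_trans[rotated])
qed

text \<open>With \<open>m = card S\<close>, the vertices \<open>v\<close> and \<open>x\<close> each
  lie in \<open>m\<close> of the pairs. Each \<open>s\<close> lies in two pairs, which leaves room
  for \<open>m - 2\<close> copies of \<open>S\<close>. The ratio \<open>3 - 2/m\<close> exceeds 2
  because \<open>m \<ge> 3\<close>.\<close>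

lemma FD_gt_two_complete_bipartite:
  assumes V: "verts G = {v, x} \<union> S" and "v \<noteq> x" "v \<notin> S" "x \<notin> S" and card: "card S \<ge> 3"
    and adj: "\<And>s. s \<in> S \<Longrightarrow> v \<rightarrow>\<^bsub>G\<^esub> s \<and> x \<rightarrow>\<^bsub>G\<^esub> s"
  shows "FD G > 2"
proof -
  let ?m = "card S"
  let ?M = "replicate_mset (?m - 2) S + image_mset (\<lambda>s. {v, s}) (mset_set S)
    + image_mset (\<lambda>s. {x, s}) (mset_set S)"
  have fin: "finite S" using V finite_verts by (metis finite_Un)
  have adj': "s \<rightarrow>\<^bsub>G\<^esub> v" "s \<rightarrow>\<^bsub>G\<^esub> x" if "s \<in> S" for s using adj[OF that] dominates_sym by auto
  have "S \<noteq> {}" using card by auto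
  have "configuration G (3 * ?m - 2) ?m ?M"
    unfolding configuration_def
  proof (intro conjI ballI)
    show "size ?M = 3 * ?m - 2" using card by simp
    have "dominating_set G S"
      using \<open>S \<noteq> {}\<close> adj by (auto simp: dominating_set_def V)
    moreover have "dominating_set G {v, s}" "dominating_set G {x, s}" if "s \<in> S" for s
      using that adj adj' by (auto simp: dominating_set_def V)
    ultimately show "dominating_set G D" if "D \<in># ?M" for D
      using that fin by (auto split: if_splits)
    fix u assume "u \<in> verts G"
    then consider "u = v" | "u = x" | "u \<in> S" using V by auto
    then show "size {#D \<in># ?M. u \<in> D#} \<le> ?m"
    proof cases
      case 3
      then have "{s \<in> S. u = v \<or> u = s} = {u}" "{s \<in> S. u = x \<or> u = s} = {u}"
        using assms by auto
      then show ?thesis using 3 card fin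
        by (simp add: filter_mset_image_mset filter_mset_replicate_mset)
    qed (use assms fin in \<open>auto simp: filter_mset_image_mset filter_mset_replicate_mset
          intro!: card_mono\<close>)
  qed
  then have "real (3 * ?m - 2) / real ?m \<le> FD G"
    using card V fin by (intro FD_ge) auto
  moreover have "2 < real (3 * ?m - 2) / real ?m"
    using card by (simp add: field_simps of_nat_diff)
  ultimately show ?thesis by (rule less_le_trans[rotated])
qed

section \<open>Recognising the exceptional graphs\<close>

lemma digraph_iso_with_proj:
  assumes inj: "inj_on f (verts G)" and V: "f ` verts G = pverts H"
    and E: "(\<lambda>(u, w). (f u, f w)) ` arcs_ends G = parcs H"
  shows "digraph_iso G (with_proj H)"
proof -
  let ?h = "\<lparr> iso_verts = f, iso_arcs = (\<lambda>e. (f (tail G e), f (head G e))),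
    iso_head = snd, iso_tail = fst \<rparr>"
  \<comment> \<open>Without parallel arcs, an arc is determined by its ends, so mapping it to the
    pair of their images is injective.\<close>
  have "inj_on (iso_arcs ?h) (arcs G)"
    using inj no_multi_arcs by (auto simp: inj_on_def arc_to_ends_def)
  then have "digraph_isomorphism ?h"
    unfolding digraph_isomorphism_def using inj wf_digraph by simp
  moreover have "with_proj H = app_iso ?h G"
    using V E by (simp add: app_iso_def with_proj_def arcs_ends_conv image_image)
  ultimately show ?thesis unfolding digraph_iso_def by blast
qed

lemma digraph_iso_cycle_graph_4:
  assumes V: "verts G = {v, x, a, b}" and dist: "distinct [v, x, a, b]"
    and E: "arcs_ends G = {(v, a), (a, v), (v, b), (b, v), (x, a), (a, x), (x, b), (b, x)}"
  shows "digraph_iso G (with_proj (cycle_graph 4))"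
proof -
  \<comment> \<open>The cyclic order is \<open>v, a, x, b\<close>; the default value 0 is the
    position of \<open>v\<close>.\<close>
  define f :: "'a \<Rightarrow> nat" where "f = (\<lambda>_. 0)(a := 1, x := 2, b := 3)"
  have f: "f v = 0" "f a = 1" "f x = 2" "f b = 3" using dist by (auto simp: f_def)
  have lt_4: "i < 4 \<longleftrightarrow> i = 0 \<or> i = 1 \<or> i = 2 \<or> i = 3" for i :: nat by arith
  have "{(i, j). i < 4 \<and> j < 4 \<and> (j = Suc i mod 4 \<or> i = Suc j mod 4)} =
      {(0, 1), (1, 0), (0, 3), (3, 0), (2, 1), (1, 2), (2, 3), (3, 2 :: nat)}"
    unfolding lt_4 by auto
  then have "(\<lambda>(u, w). (f u, f w)) ` arcs_ends G = parcs (cycle_graph 4)"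
    unfolding E by (simp add: f cycle_graph_def insert_commute)
  moreover have "f ` verts G = pverts (cycle_graph 4)"
    unfolding V by (auto simp: f cycle_graph_def lt_4)
  moreover have "inj_on f (verts G)" unfolding V by (auto simp: inj_on_def f)
  ultimately show ?thesis by (intro digraph_iso_with_proj)
qed

lemma complete_bipartite_if_not_avoidable:
  assumes tc: "two_connected G" and v: "v \<in> verts G"
    and no: "\<not> (\<exists>A B. dominating_set G A \<and> dominating_set G B \<and> A \<inter> B = {} \<and> v \<notin> A \<and> v \<notin> B)"
  shows "\<exists>x. v \<noteq> x \<and> \<not> v \<rightarrow>\<^bsub>G\<^esub> x \<and> verts G = {v, x} \<union> {s. v \<rightarrow>\<^bsub>G\<^esub> s} \<and>
    (\<forall>s w. v \<rightarrow>\<^bsub>G\<^esub> s \<longrightarrow> (s \<rightarrow>\<^bsub>G\<^esub> w \<longleftrightarrow> w = v \<or> w = x))"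
proof -
  have eq: "y = y'" if "v \<rightarrow>\<^bsub>G\<^esub> s" "v \<rightarrow>\<^bsub>G\<^esub> s'" "s \<noteq> s'" "s \<rightarrow>\<^bsub>G\<^esub> y" "s' \<rightarrow>\<^bsub>G\<^esub> y'" "y \<noteq> v" "y' \<noteq> v" for s s' y y'
    using disjoint_dominating_sets[OF tc v that(1-5) _ that(6,7)] no by blast
  obtain a b where ab: "v \<rightarrow>\<^bsub>G\<^esub> a" "v \<rightarrow>\<^bsub>G\<^esub> b" "a \<noteq> b"
    using two_connected_two_neighbours[OF tc v] by blast
  have other: "\<exists>y. s \<rightarrow>\<^bsub>G\<^esub> y \<and> y \<noteq> v" if "v \<rightarrow>\<^bsub>G\<^esub> s" for s
    using two_connected_other_neighbour[OF tc, of s v] that v adj_in_verts adj_not_same by blast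
  obtain x where x: "a \<rightarrow>\<^bsub>G\<^esub> x" "x \<noteq> v" using other ab by blast
  have nbr: "w = x" if s: "v \<rightarrow>\<^bsub>G\<^esub> s" "s \<rightarrow>\<^bsub>G\<^esub> w" "w \<noteq> v" for s w
  \<comment> \<open>Comparison with \<open>a\<close> gives \<open>w = x\<close>. For
    \<open>s = a\<close> itself, a further neighbour of \<open>b\<close> must equal both
    \<open>x\<close> and \<open>w\<close>.\<close>
  proof (cases "s = a")
    case True
    obtain y where "b \<rightarrow>\<^bsub>G\<^esub> y" "y \<noteq> v" using other ab by blast
    then show ?thesis using eq[of a b] ab x s True by metis
  next
    case False
    then show ?thesis using eq[of s a] ab x s by blast
  qed
  have adj: "s \<rightarrow>\<^bsub>G\<^esub> w \<longleftrightarrow> w = v \<or> w = x" if "v \<rightarrow>\<^bsub>G\<^esub> s" for s w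
    using nbr[OF that] other[OF that] dominates_sym[OF that] by blast
  \<comment> \<open>If \<open>x\<close> were a neighbour of \<open>v\<close>, then
    \<open>adj\<close> would give it a loop.\<close>
  have "\<not> v \<rightarrow>\<^bsub>G\<^esub> x" using adj[of x x] x(2) adj_not_same by blast
  \<comment> \<open>Neighbours of \<open>v\<close> lead only to \<open>v\<close> and
    \<open>x\<close>, so this set is closed away from \<open>x\<close>, which is no cut
    vertex.\<close>
  have "w \<in> {v} \<union> {s. v \<rightarrow>\<^bsub>G\<^esub> s}" if "w \<in> verts G - {x}" for w
    by (rule two_connected_closed_set[OF tc, of v x w]) (use that v x adj_in_verts adj in auto)
  then have "verts G = {v, x} \<union> {s. v \<rightarrow>\<^bsub>G\<^esub> s}" using v x adj_in_verts by blast
  then show ?thesis using x(2) \<open>\<not> v \<rightarrow>\<^bsub>G\<^esub> x\<close> adj by (intro exI[of _ x]) auto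
qed

end

theorem theorem20:
  fixes G :: "('a, 'b) pre_digraph"
  assumes "graph G"
    and "two_connected G"
    and "\<not> digraph_iso G (with_proj (cycle_graph 4))"
  shows "FD G > 2"
proof -
  interpret graph G by fact
  show ?thesis
  proof (cases "\<forall>v\<in>verts G. \<exists>A B. dominating_set G A \<and> dominating_set G B \<and>
      A \<inter> B = {} \<and> v \<notin> A \<and> v \<notin> B")
    case True
    then show ?thesis
      using assms(2) by (intro FD_gt_two_if_all_avoidable) (auto simp: two_connected_def)
  next
    case False
    then obtain v where v: "v \<in> verts G"
      and no: "\<not> (\<exists>A B. dominating_set G A \<and> dominating_set G B \<and> A \<inter> B = {} \<and> v \<notin> A \<and> v \<notin> B)"
      by blast
    define S where "S = {s. v \<rightarrow>\<^bsub>G\<^esub> s}"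
    obtain x where "v \<noteq> x \<and> x \<notin> S \<and> verts G = {v, x} \<union> S \<and>
        (\<forall>s w. s \<in> S \<longrightarrow> (s \<rightarrow>\<^bsub>G\<^esub> w \<longleftrightarrow> w = v \<or> w = x))"
      using complete_bipartite_if_not_avoidable[OF assms(2) v no] unfolding S_def mem_Collect_eq ..
    then have x: "v \<noteq> x" "x \<notin> S" "verts G = {v, x} \<union> S"
      and adj: "\<And>s w. s \<in> S \<Longrightarrow> s \<rightarrow>\<^bsub>G\<^esub> w \<longleftrightarrow> w = v \<or> w = x"
      by blast+
    have vS: "v \<notin> S" using adj_not_same by (auto simp: S_def)
    \<comment> \<open>Apart from \<open>x\<close> itself, only \<open>v\<close> lies outside
      \<open>S\<close>, and \<open>v\<close> is not adjacent to \<open>x\<close>.\<close>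
    have xS: "x \<rightarrow>\<^bsub>G\<^esub> s \<longleftrightarrow> s \<in> S" for s
    proof
      assume xs: "x \<rightarrow>\<^bsub>G\<^esub> s"
      have "s \<noteq> x" using xs adj_not_same by blast
      moreover have "s \<noteq> v" using dominates_sym[OF xs] x(2) by (auto simp: S_def)
      moreover have "s \<in> verts G" using xs adj_in_verts by blast
      ultimately show "s \<in> S" using x(3) by blast
    qed (use adj[of s x] dominates_sym[of s x] in blast)
    have fin: "finite S" using x(3) finite_verts by (metis finite_Un)
    obtain a b where ab: "a \<in> S" "b \<in> S" "a \<noteq> b"
      using two_connected_two_neighbours[OF assms(2) v] unfolding S_def by blast
    \<comment> \<open>Two common neighbours of \<open>v\<close> and \<open>x\<close> would give
      exactly the excluded 4-cycle.\<close>
    have "card S \<noteq> 2"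
    proof
      assume "card S = 2"
      then have S: "S = {a, b}"
        using ab fin by (intro card_seteq[symmetric]) auto
      have dist: "distinct [v, x, a, b]" using x vS ab by auto
      have nbrs: "v \<rightarrow>\<^bsub>G\<^esub> w \<longleftrightarrow> w = a \<or> w = b" "x \<rightarrow>\<^bsub>G\<^esub> w \<longleftrightarrow> w = a \<or> w = b"
        "a \<rightarrow>\<^bsub>G\<^esub> w \<longleftrightarrow> w = v \<or> w = x" "b \<rightarrow>\<^bsub>G\<^esub> w \<longleftrightarrow> w = v \<or> w = x" for w
        using adj[OF ab(1)] adj[OF ab(2)] xS S S_def by blast+
      have V: "verts G = {v, x, a, b}" using x(3) S by auto
      have "u \<in> {v, x, a, b}" if "u \<rightarrow>\<^bsub>G\<^esub> w" for u w using adj_in_verts(1)[OF that] V by simp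
      then have "(u, w) \<in> arcs_ends G \<longleftrightarrow>
          (u, w) \<in> {(v, a), (a, v), (v, b), (b, v), (x, a), (a, x), (x, b), (b, x)}" for u w
        using nbrs[of w] by blast
      then have "arcs_ends G = {(v, a), (a, v), (v, b), (b, v), (x, a), (a, x), (x, b), (b, x)}"
        by (simp add: set_eq_iff)
      then have "digraph_iso G (with_proj (cycle_graph 4))"
        by (rule digraph_iso_cycle_graph_4[OF V dist])
      then show False using assms(3) by simp
    qed
    moreover have "card {a, b} \<le> card S" using ab fin by (intro card_mono) auto
    ultimately have "card S \<ge> 3" using ab by simp
    then show ?thesis
      using x vS xS by (intro FD_gt_two_complete_bipartite[of v x S]) (auto simp: S_def)
  qed
qed

end
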